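(* Let $H$ be a graph. Then (i) $H$ is weakly norming if and only if $t_H(\cdot)$ is a convex function on the set of graphons; and (ii) $H$ is norming if and only if $t_H(\cdot)$ is a strictly convex function on the set of signed graphons.
   Context: A graphon (resp. signed graphon) is a symmetric measurable function $W:[0,1]^2\to[0,1]$ (resp. $[0,1]^2\to[-1,1]$); both sets are convex subsets of the real vector space $\mathcal{W}$ of symmetric bounded measurable functions on $[0,1]^2$. For a graph $H$ and $W\in\mathcal{W}$, $t_H(W)=\int_{[0,1]^{V(H)}}\prod_{ij\in E(H)}W(x_i,x_j)\,d\mu^{v(H)}$, with $\mu$ Lebesgue measure. Set $\|W\|_H:=|t_H(W)|^{1/e(H)}$ and $\|W\|_{r(H)}:=t_H(|W|)^{1/e(H)}$. $H$ is norming if $\|\cdot\|_H$ is a norm on $\mathcal{W}$, and weakly norming if $\|\cdot\|_{r(H)}$ is a norm on $\mathcal{W}$. A function $f$ on a convex set $C$ is convex if $f(\lambda x+(1-\lambda)y)\le\lambda f(x)+(1-\lambda)f(y)$ for all $x,y\in C$, $\lambda\in(0,1)$, and strictly convex if the inequality is strict whenever $x\ne y$. (Here $t_H$ is a graphon parameter, i.e. invariant under $W(x,y)\mapsto W(\varphi(x),\varphi(y))$ for measure-preserving bijections $\varphi$ of $[0,1]$.) *)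

theory Defs
  imports "HOL-Analysis.Analysis"
begin

definition simple_graph :: "'v set \<Rightarrow> 'v set set \<Rightarrow> bool" where
  "simple_graph V E \<longleftrightarrow> finite V \<and> (\<forall>e\<in>E. e \<subseteq> V \<and> card e = 2)"

abbreviation unit_square :: "(real \<times> real) set" where
  "unit_square \<equiv> {0..1} \<times> {0..1}"

text \<open>Kernels are total functions of which only the values on the unit square matter.
  Measurability is Lebesgue measurability.\<close>

definition kernels :: "(real \<times> real \<Rightarrow> real) set" where
  "kernels = {W. W \<in> borel_measurable (lebesgue_on unit_square)
     \<and> (\<forall>x\<in>{0..1}. \<forall>y\<in>{0..1}. W (x, y) = W (y, x))
     \<and> (\<exists>B. \<forall>p\<in>unit_square. \<bar>W p\<bar> \<le> B)}"

definition graphons :: "(real \<times> real \<Rightarrow> real) set" where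
  "graphons = {W \<in> kernels. \<forall>p\<in>unit_square. W p \<in> {0..1}}"

definition signed_graphons :: "(real \<times> real \<Rightarrow> real) set" where
  "signed_graphons = {W \<in> kernels. \<forall>p\<in>unit_square. W p \<in> {-1..1}}"

text \<open>Functions agreeing almost everywhere are identified, as usual for norms on spaces of
  measurable functions; this is the equality used in definiteness and strict convexity.\<close>

definition ae_equal :: "(real \<times> real \<Rightarrow> real) \<Rightarrow> (real \<times> real \<Rightarrow> real) \<Rightarrow> bool" where
  "ae_equal U W \<longleftrightarrow> (AE p in lebesgue_on unit_square. U p = W p)"

text \<open>The factor of an unordered edge; the description is unique because
  kernels are symmetric on the unit square.\<close>

definition edge_factor :: "(real \<times> real \<Rightarrow> real) \<Rightarrow> ('v \<Rightarrow> real) \<Rightarrow> 'v set \<Rightarrow> real" where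
  "edge_factor W x e = (THE r. \<exists>i j. e = {i, j} \<and> r = W (x i, x j))"

lemma edge_factor_doubleton:
  assumes "W \<in> kernels" "x i \<in> {0..1}" "x j \<in> {0..1}"
  shows "edge_factor W x {i, j} = W (x i, x j)"
  unfolding edge_factor_def
proof (rule the_equality)
  fix r assume "\<exists>i' j'. {i, j} = {i', j'} \<and> r = W (x i', x j')"
  then obtain i' j' where ij: "{i, j} = {i', j'}" and r: "r = W (x i', x j')" by blast
  have "W (x i, x j) = W (x j, x i)" using assms by (auto simp: kernels_def)
  with ij r show "r = W (x i, x j)" by (auto simp: doubleton_eq_iff)
qed blast

text \<open>The product measure is completed, giving Lebesgue measure on the cube indexed by \<open>V\<close>:
  for a Lebesgue measurable \<open>W\<close> the integrand need not be measurable for the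
  uncompleted product, and a Bochner integral of a non-measurable function is 0.\<close>

definition hom_density :: "'v set \<Rightarrow> 'v set set \<Rightarrow> (real \<times> real \<Rightarrow> real) \<Rightarrow> real" where
  "hom_density V E W =
     (\<integral>x. (\<Prod>e\<in>E. edge_factor W x e) \<partial>completion (Pi\<^sub>M V (\<lambda>_. lebesgue_on {0..1})))"

definition graph_norm :: "'v set \<Rightarrow> 'v set set \<Rightarrow> (real \<times> real \<Rightarrow> real) \<Rightarrow> real" where
  "graph_norm V E W = \<bar>hom_density V E W\<bar> powr (1 / real (card E))"

definition graph_rnorm :: "'v set \<Rightarrow> 'v set set \<Rightarrow> (real \<times> real \<Rightarrow> real) \<Rightarrow> real" where
  "graph_rnorm V E W = hom_density V E (\<lambda>p. \<bar>W p\<bar>) powr (1 / real (card E))"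

definition is_norm_on_kernels :: "((real \<times> real \<Rightarrow> real) \<Rightarrow> real) \<Rightarrow> bool" where
  "is_norm_on_kernels N \<longleftrightarrow>
     (\<forall>W\<in>kernels. 0 \<le> N W) \<and>
     (\<forall>W\<in>kernels. N W = 0 \<longleftrightarrow> ae_equal W (\<lambda>_. 0)) \<and>
     (\<forall>c. \<forall>W\<in>kernels. N (\<lambda>p. c * W p) = \<bar>c\<bar> * N W) \<and>
     (\<forall>U\<in>kernels. \<forall>W\<in>kernels. N (\<lambda>p. U p + W p) \<le> N U + N W)"

definition norming :: "'v set \<Rightarrow> 'v set set \<Rightarrow> bool" where
  "norming V E \<longleftrightarrow> is_norm_on_kernels (graph_norm V E)"

definition weakly_norming :: "'v set \<Rightarrow> 'v set set \<Rightarrow> bool" where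
  "weakly_norming V E \<longleftrightarrow> is_norm_on_kernels (graph_rnorm V E)"

definition convex_parameter_on ::
  "(real \<times> real \<Rightarrow> real) set \<Rightarrow> ((real \<times> real \<Rightarrow> real) \<Rightarrow> real) \<Rightarrow> bool" where
  "convex_parameter_on C f \<longleftrightarrow>
     (\<forall>U\<in>C. \<forall>W\<in>C. \<forall>l\<in>{0<..<1}.
        f (\<lambda>p. l * U p + (1 - l) * W p) \<le> l * f U + (1 - l) * f W)"

definition strictly_convex_parameter_on ::
  "(real \<times> real \<Rightarrow> real) set \<Rightarrow> ((real \<times> real \<Rightarrow> real) \<Rightarrow> real) \<Rightarrow> bool" where
  "strictly_convex_parameter_on C f \<longleftrightarrow>
     convex_parameter_on C f \<and>
     (\<forall>U\<in>C. \<forall>W\<in>C. \<forall>l\<in>{0<..<1}. \<not> ae_equal U W \<longrightarrow>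
        f (\<lambda>p. l * U p + (1 - l) * W p) < l * f U + (1 - l) * f W)"

end

theory Submission
  imports Defs
begin

text \<open>An \<open>n\<close>-homogeneous nonnegative function (\<open>n = e(H)\<close>) is convex iff its \<open>n\<close>-th root is
  subadditive: one direction is convexity of \<open>x\<^sup>n\<close>, the other convexity of the unit sublevel set.
  Definiteness in (i) comes from \<open>t\<^sub>H(1 + |W|) \<ge> 1 + \<integral>|W|\<close>, whose root is at most
  \<open>1 + \<parallel>W\<parallel>\<close>. In (ii), strict convexity at \<open>0 = W/2 + (-W)/2\<close> forces \<open>e(H)\<close> to be even and \<open>t\<^sub>H\<close>
  to be positive off 0. Conversely, for norming \<open>H\<close> the function \<open>t\<^sub>H\<close> does not vanish off 0 and is
  polynomial on lines; connectedness gives positivity and even \<open>e(H)\<close>, and equality in the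
  convexity inequality would make \<open>t\<^sub>H\<close> constant on a line.\<close>

section \<open>Lebesgue measure on the cube and its two-coordinate projections\<close>

abbreviation cube :: "'v set \<Rightarrow> ('v \<Rightarrow> real) measure" where
  "cube V \<equiv> completion (Pi\<^sub>M V (\<lambda>_. lebesgue_on {0..1}))"

lemma prob_lebesgue_on_unit: "emeasure (lebesgue_on {0..1::real}) (space (lebesgue_on {0..1})) = 1"
  by (simp add: emeasure_restrict_space)

lemma product_sigma_finite_unit: "product_sigma_finite (\<lambda>_. lebesgue_on {0..1::real})"
  unfolding product_sigma_finite_def
  using prob_lebesgue_on_unit by (intro allI finite_measure.axioms(1) finite_measureI) simp

lemma space_cube: "space (cube V) = (V \<rightarrow>\<^sub>E {0..1})"
  by (simp add: space_PiM)

lemma emeasure_space_cube: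
  assumes "finite V" shows "emeasure (cube V) (space (cube V)) = 1"
proof -
  interpret product_sigma_finite "\<lambda>_::'a. lebesgue_on {0..1::real}"
    by (rule product_sigma_finite_unit)
  have "emeasure (Pi\<^sub>M V (\<lambda>_. lebesgue_on {0..1})) (V \<rightarrow>\<^sub>E {0..1::real}) = (\<Prod>i\<in>V. 1)"
    using assms prob_lebesgue_on_unit by (subst emeasure_PiM) auto
  then show ?thesis
    using emeasure_completion[OF sets_completionI_sets, OF sets.top, of "Pi\<^sub>M V (\<lambda>_. lebesgue_on {0..1::real})"]
      main_part[OF sets.top, of "Pi\<^sub>M V (\<lambda>_. lebesgue_on {0..1::real})"]
    by (simp add: space_PiM)
qed

lemma measurable_pair_projection_borel:
  assumes "i \<in> V" "j \<in> V"
  shows "(\<lambda>x. (x i, x j)) \<in> Pi\<^sub>M V (\<lambda>_. lebesgue_on {0..1::real}) \<rightarrow>\<^sub>M borel"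
proof -
  have id: "(\<lambda>x. x) \<in> lebesgue_on {0..1::real} \<rightarrow>\<^sub>M borel"
    using id_borel_measurable_lebesgue_on by (simp add: id_def)
  have "(\<lambda>x. x k) \<in> Pi\<^sub>M V (\<lambda>_. lebesgue_on {0..1::real}) \<rightarrow>\<^sub>M borel" if "k \<in> V" for k
    using measurable_compose[OF measurable_component_singleton[OF that] id] .
  then show ?thesis
    using assms by (intro borel_measurable_Pair)
qed

text \<open>A measure on the plane that agrees with a product measure on all Borel rectangles is
  that product. The coordinates other than \<open>i\<close> and \<open>j\<close> contribute only
  factors 1.\<close>

lemma distr_pair_projection_borel:
  assumes "finite V" "i \<in> V" "j \<in> V" "i \<noteq> j"
  shows "distr (Pi\<^sub>M V (\<lambda>_. lebesgue_on {0..1::real})) borel (\<lambda>x. (x i, x j)) =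
    density lborel (indicator unit_square)"
proof -
  interpret product_sigma_finite "\<lambda>_::'a. lebesgue_on {0..1::real}"
    by (rule product_sigma_finite_unit)
  let ?M = "Pi\<^sub>M V (\<lambda>_. lebesgue_on {0..1::real})"
  \<comment> \<open>\<open>?D\<close> is the uniform law on the unit interval carried on the Borel
    sets, so that its square lives on the Borel sets of the plane.\<close>
  let ?D = "density lborel (indicator {0..1::real}) :: real measure"
  have fin: "finite_measure ?D"
    by (intro finite_measureI) (simp add: emeasure_density)
  have sf: "sigma_finite_measure ?D"
    using fin by (simp add: finite_measure.axioms(1))
  have D: "emeasure ?D A = emeasure (lebesgue_on {0..1}) (A \<inter> {0..1})" if "A \<in> sets borel" for A
    using that by (simp add: emeasure_density emeasure_restrict_space Int_commute flip: indicator_inter_arith)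
  have "?D \<Otimes>\<^sub>M ?D = distr ?M borel (\<lambda>x. (x i, x j))"
  proof (rule pair_measure_eqI[OF sf sf])
    show "sets (?D \<Otimes>\<^sub>M ?D) = sets (distr ?M borel (\<lambda>x. (x i, x j)))"
      by (simp cong: sets_pair_measure_cong) (simp add: borel_prod[symmetric])
  next
    fix A B assume "A \<in> sets ?D" "B \<in> sets ?D"
    then have A: "A \<in> sets borel" and B: "B \<in> sets borel" by auto
    \<comment> \<open>The preimage of \<open>A\<close> times \<open>B\<close> is a box with these
      sides; coordinates outside \<open>{i, j}\<close> are unconstrained.\<close>
    define F where "F = (\<lambda>k. if k = i then A \<inter> {0..1} else if k = j then B \<inter> {0..1} else {0..1::real})"
    have F: "F k \<in> sets (lebesgue_on {0..1})" for k
      using A B by (auto simp: F_def sets_restrict_space)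
    have "(\<lambda>x. (x i, x j)) -` (A \<times> B) \<inter> space ?M = Pi\<^sub>E V F"
      using assms by (auto simp: space_PiM PiE_iff F_def split: if_splits)
    then have "emeasure (distr ?M borel (\<lambda>x. (x i, x j))) (A \<times> B) = emeasure ?M (Pi\<^sub>E V F)"
      using A B assms by (subst emeasure_distr) (auto intro!: measurable_pair_projection_borel borel_Times)
    also have "\<dots> = (\<Prod>k\<in>V. emeasure (lebesgue_on {0..1}) (F k))"
      using F assms by (intro emeasure_PiM) auto
    also have "\<dots> = (\<Prod>k\<in>{i,j}. emeasure (lebesgue_on {0..1}) (F k))"
      using assms prob_lebesgue_on_unit by (intro prod.mono_neutral_right) (auto simp: F_def)
    also have "\<dots> = emeasure ?D A * emeasure ?D B"
      using assms A B by (simp add: F_def D)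
    finally show "emeasure ?D A * emeasure ?D B = emeasure (distr ?M borel (\<lambda>x. (x i, x j))) (A \<times> B)"
      by simp
  qed
  moreover have "?D \<Otimes>\<^sub>M ?D = density lborel (indicator unit_square)"
    by (subst pair_measure_density)
      (auto simp: sf lborel_prod sigma_finite_lborel indicator_times intro!: arg_cong2[where f=density] split: split_indicator)
  ultimately show ?thesis by simp
qed

text \<open>The Borel case extends to Lebesgue sets by splitting such a set into a Borel part and a
  subset of a null set. The preimage of the latter need not be measurable for the uncompleted
  product, but it is a null set of the completion.\<close>

lemma
  assumes "finite V" "i \<in> V" "j \<in> V" "i \<noteq> j"
  shows measurable_pair_projection: "(\<lambda>x. (x i, x j)) \<in> cube V \<rightarrow>\<^sub>M lebesgue_on unit_square" (is ?meas)
    and distr_pair_projection: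
      "distr (cube V) (lebesgue_on unit_square) (\<lambda>x. (x i, x j)) = lebesgue_on unit_square" (is ?distr)
proof -
  let ?M = "Pi\<^sub>M V (\<lambda>_. lebesgue_on {0..1::real})"
  let ?p = "\<lambda>x::'a \<Rightarrow> real. (x i, x j)"
  have sq [measurable]: "unit_square \<in> sets borel"
    by (intro borel_Times) auto
  have p: "?p \<in> cube V \<rightarrow>\<^sub>M lborel"
    using measurable_completion[OF measurable_pair_projection_borel[OF assms(2,3)]] by simp
  have distr: "distr (cube V) lborel ?p = density lborel (indicator unit_square)"
    using distr_pair_projection_borel[OF assms] measurable_pair_projection_borel[OF assms(2,3)]
    by (simp add: distr_completion distr_cong[OF refl sets_lborel refl])
  \<comment> \<open>The law of the projection has a density with respect to \<open>lborel\<close>,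
    so null sets pull back to null sets; this upgrades Borel measurability to Lebesgue
    measurability.\<close>
  have null: "null_sets lborel \<subseteq> null_sets (distr (cube V) lborel ?p)"
  proof
    fix N :: "(real \<times> real) set" assume N: "N \<in> null_sets lborel"
    have "AE x\<in>N in lborel. indicator unit_square x = (0::ennreal)"
      using AE_not_in[OF N] by (elim eventually_mono) auto
    then show "N \<in> null_sets (distr (cube V) lborel ?p)"
      unfolding distr using N by (subst null_sets_density_iff) auto
  qed
  have pl: "?p \<in> cube V \<rightarrow>\<^sub>M lebesgue"
    using p null by (rule completion.measurable_completion2)
  have into: "?p \<in> space (cube V) \<rightarrow> unit_square"
    using assms by (auto simp: space_PiM PiE_iff)
  show ?meas
    using pl into by (intro measurable_restrict_space2) auto
  then show ?distr
  proof (intro measure_eqI)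
    fix A assume "A \<in> sets (distr (cube V) (lebesgue_on unit_square) ?p)"
    then have A: "A \<in> sets lebesgue" "A \<subseteq> unit_square" "A \<in> sets (lebesgue_on unit_square)"
      by (auto simp: sets_restrict_space_iff)
    let ?m = "main_part lborel A"
    have m: "?m \<in> sets borel" "?m \<subseteq> A"
      using main_part_sets[OF A(1)] main_part_null_part_Un[OF A(1)] by simp_all blast
    have n: "?p -` null_part lborel A \<inter> space (cube V) \<in> null_sets (cube V)"
      using p null A by (intro completion.vimage_null_part_null_sets) auto
    have "?p -` A \<inter> space (cube V) = (?p -` ?m \<inter> space (cube V)) \<union> (?p -` null_part lborel A \<inter> space (cube V))"
      using main_part_null_part_Un[OF A(1)] by auto
    then have "emeasure (cube V) (?p -` A \<inter> space (cube V)) = emeasure (cube V) (?p -` ?m \<inter> space (cube V))"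
      using emeasure_Un_null_set[OF measurable_sets[OF p, of ?m] n] m by simp
    also have "\<dots> = emeasure (distr (cube V) lborel ?p) ?m"
      using p m by (simp add: emeasure_distr)
    also have "\<dots> = emeasure lborel ?m"
      unfolding distr using m A(2) by (subst emeasure_density) (auto simp: Int_absorb1 simp flip: indicator_inter_arith)
    also have "\<dots> = emeasure (lebesgue_on unit_square) A"
      using A by (simp add: emeasure_restrict_space)
    finally show "emeasure (distr (cube V) (lebesgue_on unit_square) ?p) A = emeasure (lebesgue_on unit_square) A"
      using \<open>?meas\<close> A by (simp add: emeasure_distr)
  qed simp
qed

section \<open>Closure properties of kernels\<close>

lemma kernels_const: "(\<lambda>_. c) \<in> kernels"
  by (auto simp: kernels_def)

lemma kernels_lincomb:
  assumes "U \<in> kernels" "W \<in> kernels"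
  shows "(\<lambda>p. a * U p + b * W p) \<in> kernels"
proof -
  obtain B C where "\<forall>p\<in>unit_square. \<bar>U p\<bar> \<le> B" "\<forall>p\<in>unit_square. \<bar>W p\<bar> \<le> C"
    using assms by (auto simp: kernels_def)
  then have "\<forall>p\<in>unit_square. \<bar>a * U p + b * W p\<bar> \<le> \<bar>a\<bar> * B + \<bar>b\<bar> * C"
    by (intro ballI order_trans[OF abs_triangle_ineq] add_mono)
      (simp_all only: abs_mult mult_left_mono abs_ge_zero)
  moreover have "(\<lambda>p. a * U p + b * W p) \<in> borel_measurable (lebesgue_on unit_square)"
    using assms by (auto simp: kernels_def)
  ultimately show ?thesis
    using assms unfolding kernels_def by auto
qed

lemma kernels_scale: "W \<in> kernels \<Longrightarrow> (\<lambda>p. c * W p) \<in> kernels"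
  using kernels_lincomb[of W W c 0] by simp

lemma kernels_add: "U \<in> kernels \<Longrightarrow> W \<in> kernels \<Longrightarrow> (\<lambda>p. U p + W p) \<in> kernels"
  using kernels_lincomb[of U W 1 1] by simp

lemma kernels_abs: "W \<in> kernels \<Longrightarrow> (\<lambda>p. \<bar>W p\<bar>) \<in> kernels"
  by (auto simp: kernels_def)

text \<open>One factor serves both kernels, so homogeneity can carry an inequality known only for
  (signed) graphons over to arbitrary pairs of kernels.\<close>

lemma kernels_scale_bounded:
  assumes "U \<in> kernels" "W \<in> kernels"
  obtains r where "r > 0" "\<And>p. p \<in> unit_square \<Longrightarrow> \<bar>r * U p\<bar> \<le> 1"
    "\<And>p. p \<in> unit_square \<Longrightarrow> \<bar>r * W p\<bar> \<le> 1"
proof -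
  obtain B C where BC: "\<forall>p\<in>unit_square. \<bar>U p\<bar> \<le> B" "\<forall>p\<in>unit_square. \<bar>W p\<bar> \<le> C"
    using assms by (auto simp: kernels_def)
  \<comment> \<open>Taking the maximum with 1 makes the divisor positive even if both bounds are
    0.\<close>
  define D where "D = max 1 (max B C)"
  show ?thesis
  proof (rule that[of "1 / D"])
    show "1 / D > 0" by (simp add: D_def)
    fix p :: "real \<times> real" assume "p \<in> unit_square"
    then have "\<bar>U p\<bar> \<le> D" "\<bar>W p\<bar> \<le> D" using BC unfolding D_def by (meson le_max_iff_disj)+
    then show "\<bar>1 / D * U p\<bar> \<le> 1" "\<bar>1 / D * W p\<bar> \<le> 1"
      using \<open>1 / D > 0\<close> by (simp_all add: abs_mult divide_le_eq)
  qed
qed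

section \<open>Homomorphism densities of a graph with at least one edge\<close>

locale nonempty_graph =
  fixes V :: "'v set" and E :: "'v set set"
  assumes graph: "simple_graph V E" and nonempty: "E \<noteq> {}"
begin

abbreviation t :: "(real \<times> real \<Rightarrow> real) \<Rightarrow> real" where "t \<equiv> hom_density V E"

lemma finite_V: "finite V"
  using graph by (simp add: simple_graph_def)

lemma finite_E: "finite E"
  using graph finite_subset[of E "Pow V"] by (auto simp: simple_graph_def)

lemma card_E_pos: "card E > 0"
  using finite_E nonempty by (simp add: card_gt_0_iff)

text \<open>Orienting the edges makes each edge factor a kernel composed with a measure-preserving map.\<close>

definition endpoints :: "'v set \<Rightarrow> ('v \<Rightarrow> real) \<Rightarrow> real \<times> real" where
  "endpoints = (SOME P. \<forall>e\<in>E. \<exists>i\<in>V. \<exists>j\<in>V. i \<noteq> j \<and> e = {i, j} \<and> P e = (\<lambda>x. (x i, x j)))"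

lemma endpoints:
  assumes "e \<in> E"
  obtains i j where "i \<in> V" "j \<in> V" "i \<noteq> j" "e = {i, j}" "endpoints e = (\<lambda>x. (x i, x j))"
proof -
  have "\<forall>e\<in>E. \<exists>p. \<exists>i\<in>V. \<exists>j\<in>V. i \<noteq> j \<and> e = {i, j} \<and> p = (\<lambda>x::'v \<Rightarrow> real. (x i, x j))"
    using graph by (fastforce simp: simple_graph_def card_2_iff)
  then have "\<exists>P. \<forall>e\<in>E. \<exists>i\<in>V. \<exists>j\<in>V. i \<noteq> j \<and> e = {i, j} \<and> P e = (\<lambda>x::'v \<Rightarrow> real. (x i, x j))"
    by (rule bchoice)
  from someI_ex[OF this] show ?thesis
    using that assms unfolding endpoints_def by blast
qed

lemma measurable_endpoints: "e \<in> E \<Longrightarrow> endpoints e \<in> cube V \<rightarrow>\<^sub>M lebesgue_on unit_square"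
  by (erule endpoints) (simp add: measurable_pair_projection[OF finite_V])

lemma distr_endpoints: "e \<in> E \<Longrightarrow> distr (cube V) (lebesgue_on unit_square) (endpoints e) = lebesgue_on unit_square"
  by (erule endpoints) (simp add: distr_pair_projection[OF finite_V])

lemma endpoints_in_square: "e \<in> E \<Longrightarrow> x \<in> space (cube V) \<Longrightarrow> endpoints e x \<in> unit_square"
  using measurable_space[OF measurable_endpoints] by simp

lemma AE_endpoints: "e \<in> E \<Longrightarrow> AE p in lebesgue_on unit_square. Q p \<Longrightarrow> AE x in cube V. Q (endpoints e x)"
  by (rule AE_distrD[OF measurable_endpoints]) (simp_all only: distr_endpoints)

lemma hom_density_eq:
  assumes "W \<in> kernels"
  shows "t W = (\<integral>x. (\<Prod>e\<in>E. W (endpoints e x)) \<partial>cube V)"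
  unfolding hom_density_def
proof (rule Bochner_Integration.integral_cong[OF refl], rule prod.cong[OF refl])
  fix x e assume x: "x \<in> space (cube V)" and e: "e \<in> E"
  from e obtain i j where "i \<in> V" "j \<in> V" "e = {i, j}" "endpoints e = (\<lambda>x. (x i, x j))"
    by (rule endpoints)
  then show "edge_factor W x e = W (endpoints e x)"
    using x edge_factor_doubleton[OF assms, of x i j] unfolding space_cube by (auto simp: PiE_iff)
qed

lemma finite_measure_cube: "finite_measure (cube V)"
  using emeasure_space_cube[OF finite_V] by (intro finite_measureI) (simp del: space_completion)

lemma integral_const_cube: "(\<integral>x. c \<partial>cube V) = (c::real)"
  using emeasure_space_cube[OF finite_V] by (simp add: measure_def del: space_completion)

lemma measurable_kernel_endpoints:
  assumes "W \<in> kernels" "e \<in> E"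
  shows "(\<lambda>x. W (endpoints e x)) \<in> borel_measurable (cube V)"
  using assms measurable_compose[OF measurable_endpoints] by (auto simp: kernels_def)

text \<open>Each edge may carry its own kernel because expanding a density along a line produces
  mixed products; the subset \<open>F\<close> also covers single edges.\<close>

lemma integrable_kernel_product:
  assumes "\<And>e. e \<in> E \<Longrightarrow> w e \<in> kernels" "F \<subseteq> E"
  shows "integrable (cube V) (\<lambda>x. \<Prod>e\<in>F. w e (endpoints e x))"
proof -
  have "\<forall>e\<in>E. \<exists>B. \<forall>p\<in>unit_square. \<bar>w e p\<bar> \<le> B"
    using assms by (auto simp: kernels_def)
  then obtain B where B: "\<And>e p. e \<in> E \<Longrightarrow> p \<in> unit_square \<Longrightarrow> \<bar>w e p\<bar> \<le> B e"
    by metis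
  show ?thesis
  proof (rule finite_measure.integrable_const_bound[OF finite_measure_cube, where B = "\<Prod>e\<in>F. B e"])
    show "(\<lambda>x. \<Prod>e\<in>F. w e (endpoints e x)) \<in> borel_measurable (cube V)"
      using assms measurable_kernel_endpoints by (intro borel_measurable_prod) auto
    show "AE x in cube V. norm (\<Prod>e\<in>F. w e (endpoints e x)) \<le> (\<Prod>e\<in>F. B e)"
    proof (rule AE_I2)
      fix x assume "x \<in> space (cube V)"
      then show "norm (\<Prod>e\<in>F. w e (endpoints e x)) \<le> (\<Prod>e\<in>F. B e)"
        unfolding real_norm_def abs_prod using B endpoints_in_square assms(2)
        by (intro prod_mono conjI abs_ge_zero) blast
    qed
  qed
qed

text \<open>Each edge projection preserves measure, so the exceptional set pulls back to a null set,
  and there are only finitely many edges.\<close>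

lemma hom_density_cong_ae:
  assumes "U \<in> kernels" "W \<in> kernels" "ae_equal U W"
  shows "t U = t W"
  unfolding hom_density_eq[OF assms(1)] hom_density_eq[OF assms(2)]
proof (rule integral_cong_AE)
  have "AE x in cube V. \<forall>e\<in>E. U (endpoints e x) = W (endpoints e x)"
    using assms(3) AE_endpoints[where Q = "\<lambda>p. U p = W p"]
    by (auto simp: AE_finite_all[OF finite_E] ae_equal_def)
  then show "AE x in cube V. (\<Prod>e\<in>E. U (endpoints e x)) = (\<Prod>e\<in>E. W (endpoints e x))"
    by (elim eventually_mono) (auto intro: prod.cong)
qed (use assms measurable_kernel_endpoints in \<open>auto intro!: borel_measurable_prod\<close>)

lemma hom_density_scale:
  assumes "W \<in> kernels" shows "t (\<lambda>p. c * W p) = c ^ card E * t W"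
  using assms by (simp add: hom_density_eq kernels_scale prod.distrib)

lemma hom_density_mono:
  assumes "U \<in> kernels" "W \<in> kernels" "\<And>p. p \<in> unit_square \<Longrightarrow> 0 \<le> U p \<and> U p \<le> W p"
  shows "t U \<le> t W"
  unfolding hom_density_eq[OF assms(1)] hom_density_eq[OF assms(2)]
proof (rule integral_mono)
  show "integrable (cube V) (\<lambda>x. \<Prod>e\<in>E. U (endpoints e x))" "integrable (cube V) (\<lambda>x. \<Prod>e\<in>E. W (endpoints e x))"
    using assms by (intro integrable_kernel_product; simp)+
  show "(\<Prod>e\<in>E. U (endpoints e x)) \<le> (\<Prod>e\<in>E. W (endpoints e x))" if "x \<in> space (cube V)" for x
    using that by (intro prod_mono assms(3) endpoints_in_square)
qed

lemma hom_density_const: "t (\<lambda>_. c) = c ^ card E"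
  unfolding hom_density_eq[OF kernels_const] integral_const_cube by simp

lemma hom_density_nonneg:
  assumes "W \<in> kernels" "\<And>p. p \<in> unit_square \<Longrightarrow> 0 \<le> W p"
  shows "0 \<le> t W"
  using hom_density_mono[of "\<lambda>_. 0" W] assms card_E_pos by (simp add: kernels_const hom_density_const power_0_left)

text \<open>All factors are at least 1, so the product dominates the factor of any single edge,
  whose integral is computed by the measure-preserving edge projection.\<close>

lemma hom_density_one_plus_ge:
  assumes W: "W \<in> kernels" and nn: "\<And>p. p \<in> unit_square \<Longrightarrow> 0 \<le> W p"
  shows "t (\<lambda>p. 1 + W p) \<ge> 1 + (\<integral>p. W p \<partial>lebesgue_on unit_square)"
proof -
  obtain e where e: "e \<in> E" using nonempty by blast
  have W1: "(\<lambda>p. 1 + W p) \<in> kernels"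
    using kernels_add[OF kernels_const W] .
  have int: "integrable (cube V) (\<lambda>x. W (endpoints e x))"
    using integrable_kernel_product[of "\<lambda>_. W" "{e}"] W e by simp
  have "(\<integral>x. 1 + W (endpoints e x) \<partial>cube V) \<le> t (\<lambda>p. 1 + W p)"
    unfolding hom_density_eq[OF W1]
  proof (rule integral_mono)
    show "integrable (cube V) (\<lambda>x. 1 + W (endpoints e x))"
      using int finite_measure.integrable_const[OF finite_measure_cube] by (intro Bochner_Integration.integrable_add)
    show "integrable (cube V) (\<lambda>x. \<Prod>e\<in>E. 1 + W (endpoints e x))"
      using integrable_kernel_product[of "\<lambda>_ p. 1 + W p" E] W1 by simp
    fix x assume x: "x \<in> space (cube V)"
    then have pos: "0 \<le> W (endpoints f x)" if "f \<in> E" for f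
      using nn that endpoints_in_square by blast
    then have "1 \<le> (\<Prod>f\<in>E - {e}. 1 + W (endpoints f x))"
      by (intro prod_ge_1) auto
    then have "1 + W (endpoints e x) \<le> (1 + W (endpoints e x)) * (\<Prod>f\<in>E - {e}. 1 + W (endpoints f x))"
      using pos[OF e] by (simp add: mult_le_cancel_left1)
    then show "1 + W (endpoints e x) \<le> (\<Prod>f\<in>E. 1 + W (endpoints f x))"
      using e finite_E by (simp add: prod.remove)
  qed
  moreover have "(\<integral>x. 1 + W (endpoints e x) \<partial>cube V) = 1 + (\<integral>x. W (endpoints e x) \<partial>cube V)"
    using int finite_measure.integrable_const[OF finite_measure_cube]
    by (subst Bochner_Integration.integral_add) (simp_all only: integral_const_cube)
  moreover have "(\<integral>x. W (endpoints e x) \<partial>cube V) = (\<integral>p. W p \<partial>lebesgue_on unit_square)"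
    using W by (subst distr_endpoints[OF e, symmetric], subst integral_distr[OF measurable_endpoints[OF e]])
      (auto simp: kernels_def)
  ultimately show ?thesis by simp
qed

text \<open>Multiplying out the product gives one term for each set \<open>F\<close> of edges on
  which \<open>U\<close> is chosen. Polynomiality later supplies the intermediate value theorem and
  the finiteness of roots.\<close>

lemma hom_density_line_poly:
  assumes "U \<in> kernels" "W \<in> kernels"
  obtains q where "\<And>s. t (\<lambda>p. U p + s * W p) = poly q s"
proof -
  define w where "w = (\<lambda>(F :: 'v set set) e. if e \<in> F then U else W)"
  define I where "I = (\<lambda>F. \<integral>x. (\<Prod>e\<in>E. w F e (endpoints e x)) \<partial>cube V)"
  have w: "w F e \<in> kernels" for F e
    using assms by (simp add: w_def)
  show ?thesis
  \<comment> \<open>Each edge outside \<open>F\<close> takes \<open>W\<close> and brings one factor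
    \<open>s\<close>, which gives the degree.\<close>
  proof (rule that[of "\<Sum>F\<in>Pow E. monom (I F) (card (E - F))"])
    fix s
    have "(\<Prod>e\<in>E. U (endpoints e x) + s * W (endpoints e x)) =
        (\<Sum>F\<in>Pow E. s ^ card (E - F) * (\<Prod>e\<in>E. w F e (endpoints e x)))" for x
    proof -
      have "(\<Prod>e\<in>F. U (endpoints e x)) * (\<Prod>e\<in>E - F. s * W (endpoints e x)) =
          s ^ card (E - F) * (\<Prod>e\<in>E. w F e (endpoints e x))" if "F \<in> Pow E" for F
      proof -
        have "(\<Prod>e\<in>E. w F e (endpoints e x)) =
            (\<Prod>e\<in>F. w F e (endpoints e x)) * (\<Prod>e\<in>E - F. w F e (endpoints e x))"
          using that finite_E prod.subset_diff[of F E] by (simp add: mult.commute)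
        then show ?thesis
          by (simp add: w_def prod.distrib)
      qed
      then show ?thesis
        by (simp add: prod_add[OF finite_E])
    qed
    moreover have "(\<lambda>p. U p + s * W p) \<in> kernels"
      using kernels_lincomb[OF assms, of 1 s] by simp
    ultimately have "t (\<lambda>p. U p + s * W p) =
        (\<integral>x. (\<Sum>F\<in>Pow E. s ^ card (E - F) * (\<Prod>e\<in>E. w F e (endpoints e x))) \<partial>cube V)"
      by (simp add: hom_density_eq)
    also have "\<dots> = (\<Sum>F\<in>Pow E. s ^ card (E - F) * I F)"
      unfolding I_def using w
      by (subst Bochner_Integration.integral_sum)
        (auto intro!: integrable_mult_right integrable_kernel_product)
    also have "\<dots> = poly (\<Sum>F\<in>Pow E. monom (I F) (card (E - F))) s"
      by (simp add: poly_sum poly_monom mult.commute)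
    finally show "t (\<lambda>p. U p + s * W p) = poly (\<Sum>F\<in>Pow E. monom (I F) (card (E - F))) s" .
  qed
qed

end

section \<open>Convexity of real powers\<close>

lemma convex_power_nonneg:
  fixes x y l :: real
  assumes "0 \<le> x" "0 \<le> y" "l \<in> {0<..<1}"
  shows "(l * x + (1 - l) * y) ^ n \<le> l * x ^ n + (1 - l) * y ^ n"
proof -
  have "convex_on {0..} (\<lambda>x::real. x ^ n)"
  proof (cases "even n")
    case True
    then show ?thesis using convex_power_even convex_on_subset by blast
  qed (rule convex_power_odd)
  \<comment> \<open>\<open>convex_onD\<close> puts its parameter on the second point, hence
    \<open>1 - l\<close>.\<close>
  from convex_onD[OF this, of "1 - l" x y] show ?thesis
    using assms by simp
qed

text \<open>The square is already strictly convex, with an explicit gap. Raising to the power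
  \<open>k\<close> is strictly increasing and convex on nonnegative reals, so it keeps the gap
  strict.\<close>

lemma strictly_convex_power_even:
  fixes x y l :: real
  assumes "x \<noteq> y" "l \<in> {0<..<1}" "even n" "n > 0"
  shows "(l * x + (1 - l) * y) ^ n < l * x ^ n + (1 - l) * y ^ n"
proof -
  obtain k where k: "n = 2 * k" "k > 0" using assms(3,4) by auto
  have "l * x\<^sup>2 + (1 - l) * y\<^sup>2 - (l * x + (1 - l) * y)\<^sup>2 = l * (1 - l) * (x - y)\<^sup>2"
    by (simp add: power2_eq_square algebra_simps)
  also have "\<dots> > 0" using assms by simp
  finally have "(l * x + (1 - l) * y)\<^sup>2 < l * x\<^sup>2 + (1 - l) * y\<^sup>2" by simp
  then have "((l * x + (1 - l) * y)\<^sup>2) ^ k < (l * x\<^sup>2 + (1 - l) * y\<^sup>2) ^ k"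
    using k by (intro power_strict_mono) auto
  also have "\<dots> \<le> l * (x\<^sup>2) ^ k + (1 - l) * (y\<^sup>2) ^ k"
    using assms by (intro convex_power_nonneg) auto
  finally show ?thesis by (simp add: k power_mult)
qed

section \<open>Almost everywhere equality and a nonconstant kernel\<close>

lemma ae_equal_square: "(\<And>p. p \<in> unit_square \<Longrightarrow> U p = W p) \<Longrightarrow> ae_equal U W"
  unfolding ae_equal_def by (intro AE_I2) simp

lemma ae_equal_zero_diff: "ae_equal (\<lambda>p. U p - W p) (\<lambda>_. 0) \<longleftrightarrow> ae_equal U W"
  by (simp add: ae_equal_def)

text \<open>Nonempty open sets have positive Lebesgue measure; this is how two kernels are shown to
  differ on a non-null set.\<close>

lemma not_AE_notin_open:
  fixes S :: "(real \<times> real) set"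
  assumes "open S" "S \<noteq> {}" "S \<subseteq> unit_square"
  shows "\<not> (AE p in lebesgue_on unit_square. p \<notin> S)"
proof
  have "unit_square \<in> sets lebesgue"
    by (intro sets_completionI_sets) (simp add: borel_Times)
  moreover assume "AE p in lebesgue_on unit_square. p \<notin> S"
  ultimately have "AE p in lebesgue. p \<in> unit_square \<longrightarrow> p \<notin> S"
    by (subst (asm) AE_restrict_space_iff) auto
  then have "AE p in lebesgue. p \<notin> S"
    by (rule eventually_mono) (use assms in blast)
  then have "S \<in> null_sets lebesgue"
    using assms(1) by (subst AE_iff_null_sets) (auto simp: borel_open)
  then show False
    using open_not_negligible[OF assms(1,2)] by (simp add: negligible_iff_null_sets)
qed

text \<open>This witness refutes odd \<open>e(H)\<close> in both directions of (ii). Every constant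
  is excluded, not just 0, because the segment argument from 1 fails for constant kernels.\<close>

lemma nonconstant_kernel:
  obtains W where "W \<in> kernels" "\<And>c. \<not> ae_equal W (\<lambda>_. c)"
proof
  \<comment> \<open>On the unit square this is the lower left quarter: the indicator is symmetric
    and takes both values 0 and 1 on nonempty open sets, so each \<open>c\<close> fails on one of
    them.\<close>
  define A where "A = {..1/2::real} \<times> {..1/2::real}"
  show "indicator A \<in> kernels"
  proof -
    have "A \<in> sets borel" unfolding A_def by (intro borel_Times) auto
    then have "indicator A \<in> borel_measurable (lebesgue_on unit_square)"
      by (intro measurable_restrict_space1 borel_measurable_indicator) simp
    moreover have "\<exists>B. \<forall>p\<in>unit_square. \<bar>indicator A p :: real\<bar> \<le> B"
      by (rule exI[of _ 1]) (auto simp: indicator_def)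
    moreover have "\<forall>x\<in>{0..1}. \<forall>y\<in>{0..1}. indicator A (x, y) = (indicator A (y, x) :: real)"
      by (auto simp: A_def indicator_def)
    ultimately show ?thesis by (simp add: kernels_def)
  qed
  fix c :: real
  show "\<not> ae_equal (indicator A) (\<lambda>_. c)"
  proof
    assume "ae_equal (indicator A) (\<lambda>_. c)"
    then have ae: "AE p in lebesgue_on unit_square. indicator A p = c"
      by (simp add: ae_equal_def)
    show False
    proof (cases "c = 1")
      case True
      let ?S = "{1/2<..<1::real} \<times> {1/2<..<1::real}"
      have "(3/4, 3/4) \<in> ?S" by simp
      then have "\<not> (AE p in lebesgue_on unit_square. p \<notin> ?S)"
        by (intro not_AE_notin_open open_Times) auto
      moreover have "AE p in lebesgue_on unit_square. p \<notin> ?S"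
        using ae by (rule eventually_mono) (auto simp: True A_def indicator_def split: if_splits)
      ultimately show False by blast
    next
      case False
      let ?S = "{0<..<1/2::real} \<times> {0<..<1/2::real}"
      have "(1/4, 1/4) \<in> ?S" by simp
      then have "\<not> (AE p in lebesgue_on unit_square. p \<notin> ?S)"
        by (intro not_AE_notin_open open_Times) auto
      moreover have "AE p in lebesgue_on unit_square. p \<notin> ?S"
        using ae by (rule eventually_mono) (use False in \<open>auto simp: A_def indicator_def split: if_splits\<close>)
      ultimately show False by blast
    qed
  qed
qed

section \<open>Convexity of norms and of their powers\<close>

lemma norm_on_kernels_convex:
  assumes "is_norm_on_kernels N" "U \<in> kernels" "W \<in> kernels" "l \<in> {0..1}"
  shows "N (\<lambda>p. l * U p + (1 - l) * W p) \<le> l * N U + (1 - l) * N W"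
proof -
  have "N (\<lambda>p. l * U p + (1 - l) * W p) \<le> N (\<lambda>p. l * U p) + N (\<lambda>p. (1 - l) * W p)"
    using assms(1) kernels_scale[OF assms(2), of l] kernels_scale[OF assms(3), of "1 - l"]
    unfolding is_norm_on_kernels_def by simp
  also have "\<dots> = l * N U + (1 - l) * N W"
    using assms unfolding is_norm_on_kernels_def by simp
  finally show ?thesis .
qed

text \<open>The power is increasing and convex on the nonnegative reals, where \<open>N\<close>
  takes its values, so composing it with the convex \<open>N\<close> preserves convexity.\<close>

lemma norm_on_kernels_power_convex:
  assumes "is_norm_on_kernels N" "U \<in> kernels" "W \<in> kernels" "l \<in> {0<..<1}"
  shows "N (\<lambda>p. l * U p + (1 - l) * W p) ^ n \<le> l * N U ^ n + (1 - l) * N W ^ n"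
proof -
  have nn: "0 \<le> N Z" if "Z \<in> kernels" for Z
    using assms(1) that by (simp add: is_norm_on_kernels_def)
  have "N (\<lambda>p. l * U p + (1 - l) * W p) ^ n \<le> (l * N U + (1 - l) * N W) ^ n"
    using assms norm_on_kernels_convex[OF assms(1-3), of l] nn kernels_lincomb
    by (intro power_mono) auto
  also have "\<dots> \<le> l * N U ^ n + (1 - l) * N W ^ n"
    using assms nn by (intro convex_power_nonneg) auto
  finally show ?thesis .
qed

section \<open>Roots of the density and their triangle inequality\<close>

context nonempty_graph
begin

lemma power_root:
  assumes "0 \<le> x" shows "(x powr (1 / real (card E))) ^ card E = x"
proof (cases "x = 0")
  \<comment> \<open>\<open>0 powr a\<close> is 0 by convention, and the positive exponent
    \<open>card E\<close> keeps it 0.\<close>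
  case True
  then show ?thesis using card_E_pos by (simp add: power_0_left)
next
  case False
  then show ?thesis using card_E_pos assms by (subst powr_power) auto
qed

lemma root_scaled_power:
  assumes "0 \<le> x" "0 \<le> c"
  shows "(c ^ card E * x) powr (1 / real (card E)) = c * x powr (1 / real (card E))"
proof (rule power_eq_imp_eq_base[OF _ _ _ card_E_pos])
  show "((c ^ card E * x) powr (1 / real (card E))) ^ card E = (c * x powr (1 / real (card E))) ^ card E"
    using assms by (simp only: power_root mult_nonneg_nonneg zero_le_power power_mult_distrib)
qed (use assms in auto)

lemma hom_density_ae_zero: "W \<in> kernels \<Longrightarrow> ae_equal W (\<lambda>_. 0) \<Longrightarrow> t W = 0"
  using hom_density_cong_ae[OF _ kernels_const, of W 0] hom_density_const[of 0] card_E_pos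
  by (simp add: power_0_left)

text \<open>This is the Minkowski functional argument: \<open>U / a\<close> and \<open>W / b\<close>
  lie in the unit sublevel set of \<open>t\<close>, and \<open>(U + W) / (a + b)\<close> is a convex
  combination of them. Convexity is available only on \<open>K\<close>, so \<open>scale\<close>
  first shrinks both points by a common \<open>r\<close>, which homogeneity removes at the
  end.\<close>

lemma root_hom_density_triangle:
  assumes conv: "convex_parameter_on K t"
    and U: "U \<in> kernels" and W: "W \<in> kernels"
    and scale: "\<And>a b. 0 < a \<Longrightarrow> 0 < b \<Longrightarrow> \<exists>r>0. (\<lambda>p. r * a * U p) \<in> K \<and> (\<lambda>p. r * b * W p) \<in> K"
    and nn: "0 \<le> t U" "0 \<le> t W" "0 \<le> t (\<lambda>p. U p + W p)"
  shows "t (\<lambda>p. U p + W p) powr (1 / real (card E)) \<le>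
    t U powr (1 / real (card E)) + t W powr (1 / real (card E))"
proof (rule field_le_epsilon)
  fix \<epsilon> :: real assume \<epsilon>: "\<epsilon> > 0"
  let ?n = "card E"
  \<comment> \<open>Half of the slack goes to each root, so that division by \<open>a\<close> and
    \<open>b\<close> is possible even where a density is 0.\<close>
  define a b where "a = t U powr (1 / real ?n) + \<epsilon> / 2" and "b = t W powr (1 / real ?n) + \<epsilon> / 2"
  have ab: "0 < a" "0 < b"
    using \<epsilon> by (simp_all add: a_def b_def add_nonneg_pos)
  have "t U = (t U powr (1 / real ?n)) ^ ?n" "t W = (t W powr (1 / real ?n)) ^ ?n"
    using nn by (simp_all add: power_root)
  then have le: "t U \<le> a ^ ?n" "t W \<le> b ^ ?n"
    using \<epsilon> by (metis a_def b_def power_mono powr_ge_zero le_add_same_cancel1 half_gt_zero less_imp_le)+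
  obtain r where r: "r > 0" "(\<lambda>p. r * (1 / a) * U p) \<in> K" "(\<lambda>p. r * (1 / b) * W p) \<in> K"
    using scale[of "1 / a" "1 / b"] ab by auto
  \<comment> \<open>With these weights \<open>a\<close> and \<open>b\<close> cancel, leaving the
    common factor \<open>r / (a + b)\<close> for \<open>U\<close> and \<open>W\<close>.\<close>
  define l where "l = a / (a + b)"
  have l: "l \<in> {0<..<1}" "1 - l = b / (a + b)"
    using ab by (auto simp: l_def field_simps)
  have eq: "(\<lambda>p. l * (r * (1 / a) * U p) + (1 - l) * (r * (1 / b) * W p)) =
      (\<lambda>p. r / (a + b) * (U p + W p))"
  proof
    fix p
    have "l * (r * (1 / a) * U p) = r / (a + b) * U p" "(1 - l) * (r * (1 / b) * W p) = r / (a + b) * W p"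
      unfolding l(2) unfolding l_def using ab by simp_all
    then show "l * (r * (1 / a) * U p) + (1 - l) * (r * (1 / b) * W p) = r / (a + b) * (U p + W p)"
      by (simp only: distrib_left)
  qed
  have "t (\<lambda>p. r / (a + b) * (U p + W p)) \<le>
      l * t (\<lambda>p. r * (1 / a) * U p) + (1 - l) * t (\<lambda>p. r * (1 / b) * W p)"
    using conv[unfolded convex_parameter_on_def, rule_format, OF r(2,3) l(1)] unfolding eq .
  also have "t (\<lambda>p. r * (1 / a) * U p) = (r / a) ^ ?n * t U"
    using hom_density_scale[OF U, of "r / a"] by simp
  also have "t (\<lambda>p. r * (1 / b) * W p) = (r / b) ^ ?n * t W"
    using hom_density_scale[OF W, of "r / b"] by simp
  also have "l * ((r / a) ^ ?n * t U) + (1 - l) * ((r / b) ^ ?n * t W) \<le> l * r ^ ?n + (1 - l) * r ^ ?n"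
    using l(1) le ab r(1) by (intro add_mono mult_left_mono) (auto simp: power_divide divide_le_eq mult_left_mono)
  also have "\<dots> = r ^ ?n"
    by (simp add: algebra_simps)
  finally have "(r / (a + b)) ^ ?n * t (\<lambda>p. U p + W p) \<le> r ^ ?n"
    unfolding hom_density_scale[OF kernels_add[OF U W]] .
  then have "t (\<lambda>p. U p + W p) \<le> (a + b) ^ ?n * 1"
    using r(1) ab by (simp add: power_divide divide_le_eq)
  then have "t (\<lambda>p. U p + W p) powr (1 / real ?n) \<le> ((a + b) ^ ?n * 1) powr (1 / real ?n)"
    using nn(3) by (intro powr_mono2) auto
  also have "\<dots> = a + b"
    using ab by (subst root_scaled_power) auto
  finally show "t (\<lambda>p. U p + W p) powr (1 / real ?n) \<le>
      t U powr (1 / real ?n) + t W powr (1 / real ?n) + \<epsilon>"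
    by (simp add: a_def b_def)
qed

section \<open>Weakly norming graphs and convexity on graphons\<close>

lemma graph_rnorm_power:
  assumes "W \<in> graphons" shows "graph_rnorm V E W ^ card E = t W"
proof -
  have W: "W \<in> kernels" "\<And>p. p \<in> unit_square \<Longrightarrow> 0 \<le> W p"
    using assms by (auto simp: graphons_def)
  \<comment> \<open>A graphon may be negative off the unit square, so the two functions are compared
    only on the square.\<close>
  then have "t (\<lambda>p. \<bar>W p\<bar>) = t W"
    by (intro hom_density_cong_ae kernels_abs ae_equal_square) auto
  then show ?thesis
    using hom_density_nonneg[OF W] by (simp add: graph_rnorm_def power_root)
qed

lemma convex_if_weakly_norming:
  assumes "weakly_norming V E"
  shows "convex_parameter_on graphons t"
  unfolding convex_parameter_on_def
proof (intro ballI)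
  fix U W and l :: real assume UW: "U \<in> graphons" "W \<in> graphons" and l: "l \<in> {0<..<1}"
  then have "(\<lambda>p. l * U p + (1 - l) * W p) \<in> graphons"
    by (auto simp: graphons_def intro!: kernels_lincomb convex_bound_le)
  moreover have "U \<in> kernels" "W \<in> kernels" using UW by (auto simp: graphons_def)
  ultimately show "t (\<lambda>p. l * U p + (1 - l) * W p) \<le> l * t U + (1 - l) * t W"
    using norm_on_kernels_power_convex[of "graph_rnorm V E" U W l "card E"] assms UW l
    by (simp add: weakly_norming_def graph_rnorm_power)
qed

text \<open>Convexity is known for nonnegative kernels only, so the triangle inequality is proved
  for absolute values and then weakened by monotonicity of \<open>t\<close>.\<close>

lemma weakly_norming_if_convex:
  assumes conv: "convex_parameter_on graphons t"
  shows "weakly_norming V E"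
proof -
  let ?N = "graph_rnorm V E"
  have nn: "0 \<le> t (\<lambda>p. \<bar>W p\<bar>)" if "W \<in> kernels" for W
    using that by (intro hom_density_nonneg kernels_abs) auto
  have sum: "(\<lambda>p. \<bar>U p\<bar> + \<bar>W p\<bar>) \<in> kernels" if "U \<in> kernels" "W \<in> kernels" for U W
    using that by (intro kernels_add[of "\<lambda>p. \<bar>U p\<bar>" "\<lambda>p. \<bar>W p\<bar>"] kernels_abs)
  \<comment> \<open>This is stronger than subadditivity of \<open>?N\<close>; taking the constant 1
    for \<open>U\<close>, it also yields definiteness.\<close>
  have tri: "t (\<lambda>p. \<bar>U p\<bar> + \<bar>W p\<bar>) powr (1 / real (card E)) \<le> ?N U + ?N W"
    if UW: "U \<in> kernels" "W \<in> kernels" for U W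
    unfolding graph_rnorm_def
  proof (rule root_hom_density_triangle[OF conv])
    show "0 \<le> t (\<lambda>p. \<bar>U p\<bar> + \<bar>W p\<bar>)"
      using sum[OF UW] by (rule hom_density_nonneg) auto
    fix a b :: real assume ab: "0 < a" "0 < b"
    obtain r where r: "r > 0" "\<And>p. p \<in> unit_square \<Longrightarrow> \<bar>r * (a * U p)\<bar> \<le> 1"
      "\<And>p. p \<in> unit_square \<Longrightarrow> \<bar>r * (b * W p)\<bar> \<le> 1"
      using kernels_scale_bounded[OF kernels_scale[OF UW(1), of a] kernels_scale[OF UW(2), of b]] by blast
    have "(\<lambda>p. r * a * \<bar>U p\<bar>) \<in> graphons" "(\<lambda>p. r * b * \<bar>W p\<bar>) \<in> graphons"
      unfolding graphons_def using r(1) ab r(2)[unfolded abs_mult] r(3)[unfolded abs_mult]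
      by (auto intro!: kernels_scale kernels_abs UW simp: mult.assoc)
    with r(1) show "\<exists>r>0. (\<lambda>p. r * a * \<bar>U p\<bar>) \<in> graphons \<and> (\<lambda>p. r * b * \<bar>W p\<bar>) \<in> graphons"
      by blast
  qed (use UW nn in \<open>auto intro: kernels_abs\<close>)
  have "?N (\<lambda>p. U p + W p) \<le> ?N U + ?N W" if UW: "U \<in> kernels" "W \<in> kernels" for U W
  proof -
    have "t (\<lambda>p. \<bar>U p + W p\<bar>) \<le> t (\<lambda>p. \<bar>U p\<bar> + \<bar>W p\<bar>)"
      using kernels_abs[OF kernels_add[OF UW]] sum[OF UW] by (rule hom_density_mono) auto
    then have "?N (\<lambda>p. U p + W p) \<le> t (\<lambda>p. \<bar>U p\<bar> + \<bar>W p\<bar>) powr (1 / real (card E))"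
      unfolding graph_rnorm_def using nn[OF kernels_add[OF UW]] by (intro powr_mono2) auto
    with tri[OF UW] show ?thesis by linarith
  qed
  moreover have "?N (\<lambda>p. c * W p) = \<bar>c\<bar> * ?N W" if "W \<in> kernels" for c W
    using that nn[OF that] hom_density_scale[OF kernels_abs[OF that], of "\<bar>c\<bar>"]
    by (simp add: graph_rnorm_def abs_mult root_scaled_power)
  moreover have "?N W = 0 \<longleftrightarrow> ae_equal W (\<lambda>_. 0)" if W: "W \<in> kernels" for W
  proof
    assume "ae_equal W (\<lambda>_. 0)"
    then have "ae_equal (\<lambda>p. \<bar>W p\<bar>) (\<lambda>_. 0)" by (simp add: ae_equal_def)
    then show "?N W = 0" using hom_density_ae_zero[OF kernels_abs[OF W]] by (simp add: graph_rnorm_def)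
  next
    assume N0: "?N W = 0"
    let ?L = "lebesgue_on unit_square"
    have "t (\<lambda>p. 1 + \<bar>W p\<bar>) powr (1 / real (card E)) \<le> 1"
      using tri[OF kernels_const[of 1] W] N0 hom_density_const[of 1]
      by (simp add: graph_rnorm_def)
    moreover have ge: "1 + (\<integral>p. \<bar>W p\<bar> \<partial>?L) \<le> t (\<lambda>p. 1 + \<bar>W p\<bar>)"
      using W by (intro hom_density_one_plus_ge kernels_abs) auto
    moreover have int_nn: "0 \<le> (\<integral>p. \<bar>W p\<bar> \<partial>?L)"
      by simp
    \<comment> \<open>The density is both at most 1 and at least 1 plus the integral of
      \<open>W\<close> in absolute value, so that integral vanishes.\<close>
    ultimately have "(t (\<lambda>p. 1 + \<bar>W p\<bar>) powr (1 / real (card E))) ^ card E \<le> 1"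
      by (intro power_le_one) auto
    then have "(\<integral>p. \<bar>W p\<bar> \<partial>?L) = 0"
      using ge int_nn power_root[of "t (\<lambda>p. 1 + \<bar>W p\<bar>)"] by linarith
    \<comment> \<open>Integrability matters here: the Bochner integral of a non-integrable function
      is 0 by convention.\<close>
    moreover have "integrable ?L (\<lambda>p. \<bar>W p\<bar>)"
    proof -
      obtain B where "\<forall>p\<in>unit_square. \<bar>W p\<bar> \<le> B" using W by (auto simp: kernels_def)
      moreover have "unit_square \<in> lmeasurable"
        using lmeasurable_cbox[of "(0,0)" "(1,1) :: real \<times> real"] by (simp add: cbox_Pair_eq)
      ultimately show ?thesis
        using W by (intro finite_measure.integrable_const_bound[OF finite_measure_lebesgue_on, where B = B])
          (auto simp: kernels_def simp del: mem_Times_iff)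
    qed
    ultimately have "AE p in ?L. \<bar>W p\<bar> = 0"
      by (subst (asm) integral_nonneg_eq_0_iff_AE) auto
    then show "ae_equal W (\<lambda>_. 0)" by (simp add: ae_equal_def)
  qed
  ultimately show ?thesis
    by (auto simp: weakly_norming_def is_norm_on_kernels_def graph_rnorm_def)
qed

section \<open>From strict convexity on signed graphons to norming\<close>

lemma graph_norm_scale:
  assumes "W \<in> kernels" shows "graph_norm V E (\<lambda>p. c * W p) = \<bar>c\<bar> * graph_norm V E W"
  unfolding graph_norm_def hom_density_scale[OF assms] abs_mult power_abs
  by (rule root_scaled_power) auto

text \<open>The triangle inequality for roots needs \<open>t\<close> nonnegative and definiteness
  needs it nonzero off 0; both come from comparing \<open>W\<close> with its negative.\<close>

lemma norming_if_strictly_convex: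
  assumes "strictly_convex_parameter_on signed_graphons t"
  shows "norming V E"
proof -
  have conv: "convex_parameter_on signed_graphons t"
    and strict: "\<And>U W l. U \<in> signed_graphons \<Longrightarrow> W \<in> signed_graphons \<Longrightarrow> l \<in> {0<..<1} \<Longrightarrow>
      \<not> ae_equal U W \<Longrightarrow> t (\<lambda>p. l * U p + (1 - l) * W p) < l * t U + (1 - l) * t W"
    using assms unfolding strictly_convex_parameter_on_def by blast+
  have t0: "t (\<lambda>_. 0) = 0"
    using hom_density_const[of 0] card_E_pos by (simp add: power_0_left)
  have scaled: "\<exists>r>0. (\<lambda>p. r * a * U p) \<in> signed_graphons \<and> (\<lambda>p. r * b * W p) \<in> signed_graphons"
    if UW: "U \<in> kernels" "W \<in> kernels" for U W a b
  proof -
    obtain r where r: "r > 0" "\<And>p. p \<in> unit_square \<Longrightarrow> \<bar>r * (a * U p)\<bar> \<le> 1"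
      "\<And>p. p \<in> unit_square \<Longrightarrow> \<bar>r * (b * W p)\<bar> \<le> 1"
      using kernels_scale_bounded[OF kernels_scale[OF UW(1), of a] kernels_scale[OF UW(2), of b]] by blast
    have "(\<lambda>p. r * a * U p) \<in> signed_graphons"
      using kernels_scale[OF UW(1), of "r * a"] r(2) unfolding signed_graphons_def abs_le_iff
      by (simp add: mult.assoc minus_le_iff)
    moreover have "(\<lambda>p. r * b * W p) \<in> signed_graphons"
      using kernels_scale[OF UW(2), of "r * b"] r(3) unfolding signed_graphons_def abs_le_iff
      by (simp add: mult.assoc minus_le_iff)
    ultimately show ?thesis using r(1) by blast
  qed
  \<comment> \<open>The zero kernel is the midpoint of \<open>r W\<close> and \<open>- r W\<close>,
    so strict convexity puts \<open>t 0 = 0\<close> strictly below the average of their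
    densities.\<close>
  have mid: "0 < r ^ card E * (t W + (-1) ^ card E * t W)"
    if W: "W \<in> kernels" "\<not> ae_equal W (\<lambda>_. 0)"
      and r: "0 < r" "(\<lambda>p. r * 1 * W p) \<in> signed_graphons" "(\<lambda>p. r * (-1) * W p) \<in> signed_graphons" for W r
  proof -
    have "\<not> ae_equal (\<lambda>p. r * 1 * W p) (\<lambda>p. r * (-1) * W p)"
      using W(2) r(1) by (auto simp: ae_equal_def elim!: contrapos_nn eventually_mono)
    from strict[OF r(2,3) _ this, of "1/2"] show ?thesis
      using t0 hom_density_scale[OF W(1), of "r * 1"] hom_density_scale[OF W(1), of "r * (-1)"]
      unfolding power_mult_distrib by (simp add: algebra_simps)
  qed
  have sym_pos: "0 < t W + (-1) ^ card E * t W" if W: "W \<in> kernels" "\<not> ae_equal W (\<lambda>_. 0)" for W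
  proof -
    obtain r where r: "0 < r" "(\<lambda>p. r * 1 * W p) \<in> signed_graphons" "(\<lambda>p. r * (-1) * W p) \<in> signed_graphons"
      using scaled[OF W(1) W(1), of 1 "-1"] by blast
    show ?thesis
      using mid[OF W r] r(1) by (simp add: zero_less_mult_iff)
  qed
  \<comment> \<open>For odd \<open>card E\<close> the two terms of \<open>sym_pos\<close> cancel,
    giving \<open>0 < 0\<close> at any kernel that is not almost everywhere 0.\<close>
  have "even (card E)"
  proof (rule ccontr)
    obtain W where W: "W \<in> kernels" "\<not> ae_equal W (\<lambda>_. 0)"
      using nonconstant_kernel by metis
    assume "odd (card E)"
    then show False using sym_pos[OF W] by simp
  qed
  then have pos: "0 < t W" if "W \<in> kernels" "\<not> ae_equal W (\<lambda>_. 0)" for W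
    using sym_pos[OF that] by simp
  have nn: "0 \<le> t W" if "W \<in> kernels" for W
    using pos[OF that] hom_density_ae_zero[OF that] by fastforce
  have "graph_norm V E W = 0 \<longleftrightarrow> ae_equal W (\<lambda>_. 0)" if "W \<in> kernels" for W
    using pos[OF that] hom_density_ae_zero[OF that]
    by (cases "ae_equal W (\<lambda>_. 0)") (auto simp: graph_norm_def)
  moreover have "graph_norm V E (\<lambda>p. U p + W p) \<le> graph_norm V E U + graph_norm V E W"
    if UW: "U \<in> kernels" "W \<in> kernels" for U W
    using root_hom_density_triangle[OF conv UW scaled[OF UW] nn[OF UW(1)] nn[OF UW(2)] nn[OF kernels_add[OF UW]]]
      nn[OF UW(1)] nn[OF UW(2)] nn[OF kernels_add[OF UW]]
    by (simp add: graph_norm_def)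
  ultimately show ?thesis
    unfolding norming_def is_norm_on_kernels_def
    using graph_norm_scale by (simp add: graph_norm_def)
qed

section \<open>From norming to strict convexity on signed graphons\<close>

context
  assumes norming: "norming V E"
begin

lemma norming_ae_zero: "W \<in> kernels \<Longrightarrow> t W = 0 \<Longrightarrow> ae_equal W (\<lambda>_. 0)"
  using norming unfolding norming_def is_norm_on_kernels_def by (simp add: graph_norm_def)

text \<open>The segment from 1 to a non-constant kernel avoids 0, so \<open>t\<close> cannot change sign on it.\<close>

lemma norming_hom_density_pos_nonconstant:
  assumes W: "W \<in> kernels" and nonconst: "\<And>c. \<not> ae_equal W (\<lambda>_. c)"
  shows "0 < t W"
proof (rule ccontr)
  assume "\<not> 0 < t W"
  moreover have "t W \<noteq> 0"
    using norming_ae_zero[OF W] nonconst by blast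
  ultimately have neg: "t W < 0" by linarith
  have D: "(\<lambda>p. W p - 1) \<in> kernels"
    using kernels_lincomb[OF W kernels_const, of 1 "-1" 1] by simp
  obtain q where q: "\<And>s. t (\<lambda>p. 1 + s * (W p - 1)) = poly q s"
    using hom_density_line_poly[OF kernels_const D] by blast
  have "poly q 0 > 0" "poly q 1 < 0"
    using q[of 0] q[of 1] neg hom_density_const[of 1] by simp_all
  then obtain s where s: "0 < s" "poly q s = 0"
    using poly_IVT_neg[of 0 1 q] by auto
  have "(\<lambda>p. 1 + s * (W p - 1)) \<in> kernels"
    using kernels_lincomb[OF kernels_const D, of 1 1 s] by simp
  then have "ae_equal (\<lambda>p. 1 + s * (W p - 1)) (\<lambda>_. 0)"
    using q s norming_ae_zero by simp
  then have "ae_equal W (\<lambda>_. 1 - 1 / s)"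
    using s(1) unfolding ae_equal_def by (elim eventually_mono) (simp add: field_simps)
  then show False using nonconst by blast
qed

text \<open>The negative of a nonconstant kernel is nonconstant as well, so both have positive
  density; for an odd number of edges the densities would be opposite.\<close>

lemma norming_even: "even (card E)"
proof (rule ccontr)
  assume odd: "odd (card E)"
  obtain W where W: "W \<in> kernels" "\<And>c. \<not> ae_equal W (\<lambda>_. c)"
    using nonconstant_kernel by blast
  have "\<not> ae_equal (\<lambda>p. -1 * W p) (\<lambda>_. c)" for c
    using W(2)[of "- c"] unfolding ae_equal_def by (auto elim!: contrapos_nn eventually_mono)
  then have "0 < t (\<lambda>p. -1 * W p)"
    using kernels_scale[OF W(1)] by (intro norming_hom_density_pos_nonconstant)
  then show False
    using norming_hom_density_pos_nonconstant[OF W] odd hom_density_scale[OF W(1), of "-1"] by simp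
qed

text \<open>Constant kernels escape the segment argument, but their density is an even
  power.\<close>

lemma norming_hom_density_nonneg:
  assumes W: "W \<in> kernels" shows "0 \<le> t W"
proof (cases "\<exists>c. ae_equal W (\<lambda>_. c)")
  case True
  then obtain c where "ae_equal W (\<lambda>_. c)" by blast
  then have "t W = c ^ card E"
    using hom_density_cong_ae[OF W kernels_const] hom_density_const by simp
  then show ?thesis using norming_even by (simp add: zero_le_even_power)
next
  case False
  then show ?thesis using norming_hom_density_pos_nonconstant[OF W] by fastforce
qed

lemma norming_hom_density_eq: "W \<in> kernels \<Longrightarrow> t W = graph_norm V E W ^ card E"
  using norming_hom_density_nonneg[of W] by (simp add: graph_norm_def power_root)

text \<open>If equality held, the norm would be constant on the segment from \<open>W\<close> to \<open>U\<close>. As \<open>t\<close> is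
  polynomial along the line through \<open>U\<close> and \<open>W\<close>, it would be constant on that whole line,
  but a norm is unbounded there.\<close>

lemma norming_strict_inequality:
  assumes U: "U \<in> kernels" and W: "W \<in> kernels" and l: "l \<in> {0<..<1}" and neq: "\<not> ae_equal U W"
  shows "t (\<lambda>p. l * U p + (1 - l) * W p) < l * t U + (1 - l) * t W"
proof (rule ccontr)
  let ?N = "graph_norm V E" and ?n = "card E"
  note N = norming[unfolded norming_def]
  assume not_less: "\<not> ?thesis"
  define D where "D = (\<lambda>p. U p - W p)"
  have D: "D \<in> kernels"
    unfolding D_def using kernels_lincomb[OF U W, of 1 "-1"] by simp
  define L where "L = (\<lambda>s p. W p + s * D p)"
  have L: "L s \<in> kernels" for s
    unfolding L_def using kernels_lincomb[OF W D, of 1 s] by simp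
  have L_lincomb: "(\<lambda>p. a * L s p + (1 - a) * L s' p) = L (a * s + (1 - a) * s')" for a s s'
    by (simp add: L_def fun_eq_iff algebra_simps)
  have L01: "L 0 = W" "L 1 = U"
    by (simp_all add: L_def D_def)
  have nn: "0 \<le> ?N Z" for Z by (simp add: graph_norm_def)
  have N_convex: "?N (L (a * s + (1 - a) * s')) \<le> a * ?N (L s) + (1 - a) * ?N (L s')"
    if "a \<in> {0..1}" for a s s'
    using norm_on_kernels_convex[OF N L L that] unfolding L_lincomb .
  have "(\<lambda>p. l * U p + (1 - l) * W p) = L l"
    using L_lincomb[of l 1 0] by (simp add: L01)
  with not_less have ge: "l * ?N U ^ ?n + (1 - l) * ?N W ^ ?n \<le> ?N (L l) ^ ?n"
    using norming_hom_density_eq U W L by simp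
  have le: "?N (L l) \<le> l * ?N U + (1 - l) * ?N W"
    using N_convex[of l 1 0] l by (simp add: L01)
  then have le_n: "?N (L l) ^ ?n \<le> (l * ?N U + (1 - l) * ?N W) ^ ?n"
    using nn by (intro power_mono)
  \<comment> \<open>Unequal endpoint norms would give a strict inequality for the even power,
    contradicting the assumed lower bound \<open>ge\<close>.\<close>
  have eq: "?N U = ?N W"
  proof (rule ccontr)
    assume "?N U \<noteq> ?N W"
    from strictly_convex_power_even[OF this l norming_even card_E_pos] show False
      using ge le_n by linarith
  qed
  define r where "r = ?N W"
  have "r ^ ?n \<le> ?N (L l) ^ ?n"
    using ge eq by (simp add: r_def algebra_simps)
  then have r_le: "r \<le> ?N (L l)"
    using power_mono_iff[of r "?N (L l)" ?n] nn card_E_pos by (simp add: r_def)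
  have const: "?N (L s) = r" if s: "s \<in> {0<..<l}" for s
  proof (rule antisym)
    show "?N (L s) \<le> r"
      using N_convex[of s 1 0] s l eq by (simp add: L01 r_def algebra_simps)
    \<comment> \<open>For \<open>s < l\<close> the point \<open>L l\<close> lies between
      \<open>L s\<close> and \<open>L 1\<close>, with weight \<open>a\<close> on \<open>L s\<close>.
      Since \<open>L l\<close> and \<open>L 1\<close> have norm at least \<open>r\<close> and
      exactly \<open>r\<close>, convexity bounds the norm of \<open>L s\<close> from below.\<close>
    define a where "a = (1 - l) / (1 - s)"
    have "a * (1 - s) = 1 - l" "a \<in> {0<..1}"
      using s l by (auto simp: a_def)
    then have a: "a \<in> {0<..1}" "a * s + (1 - a) * 1 = l"
      by (auto simp: algebra_simps)
    have "r \<le> a * ?N (L s) + (1 - a) * r"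
      using N_convex[of a s 1] a r_le eq by (simp add: L01 r_def)
    then have "a * r \<le> a * ?N (L s)" by (simp add: algebra_simps)
    then show "r \<le> ?N (L s)" using a(1) by simp
  qed
  obtain q where q: "\<And>s. t (L s) = poly q s"
    using hom_density_line_poly[OF W D] unfolding L_def by blast
  have qN: "poly q s = ?N (L s) ^ ?n" for s
    using q[of s] norming_hom_density_eq[OF L, of s] by simp
  \<comment> \<open>The polynomial has every point of the open interval from 0 to \<open>l\<close>
    as a root, so it is zero.\<close>
  have "q - [:r ^ ?n:] = 0"
  proof (rule ccontr)
    assume "q - [:r ^ ?n:] \<noteq> 0"
    then have "finite {s. poly (q - [:r ^ ?n:]) s = 0}" by (rule poly_roots_finite)
    moreover have "{0<..<l} \<subseteq> {s. poly (q - [:r ^ ?n:]) s = 0}"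
      using const by (auto simp: qN)
    ultimately have "finite {0<..<l}" by (rule rev_finite_subset)
    then show False using l infinite_Ioo[of 0 l] by simp
  qed
  then have "?N (L s) ^ ?n = r ^ ?n" for s
    using qN[of s] by (simp add: algebra_simps)
  then have all: "?N (L s) = r" for s
    using power_eq_imp_eq_base[OF _ nn _ card_E_pos] nn by (simp add: r_def)
  have ND: "?N D > 0"
    using N D nn[of D] neq ae_equal_zero_diff[of U W] unfolding is_norm_on_kernels_def D_def by force
  \<comment> \<open>The triangle inequality bounds the norm of \<open>s D = L s - W\<close> by
    \<open>2 * r\<close>; this \<open>s\<close> makes that norm \<open>2 * r + 1\<close>.\<close>
  define s where "s = (2 * r + 1) / ?N D"
  have sD: "(\<lambda>p. s * D p) = (\<lambda>p. L s p + (-1) * W p)"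
    by (simp add: L_def)
  have triangle: "?N (\<lambda>p. X p + Y p) \<le> ?N X + ?N Y" if "X \<in> kernels" "Y \<in> kernels" for X Y
    using N that unfolding is_norm_on_kernels_def by blast
  have "?N (\<lambda>p. s * D p) \<le> ?N (L s) + ?N (\<lambda>p. (-1) * W p)"
    unfolding sD using L kernels_scale[OF W] by (rule triangle)
  then have "\<bar>s\<bar> * ?N D \<le> r + r"
    using graph_norm_scale[OF D, of s] graph_norm_scale[OF W, of "-1"] all by (simp add: r_def)
  moreover have "\<bar>s\<bar> * ?N D = 2 * r + 1"
    using ND nn[of W] by (simp add: s_def r_def)
  ultimately show False by simp
qed

lemma strictly_convex_if_norming: "strictly_convex_parameter_on signed_graphons t"
  unfolding strictly_convex_parameter_on_def convex_parameter_on_def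
proof (intro conjI ballI impI)
  fix U W and l :: real assume "U \<in> signed_graphons" "W \<in> signed_graphons" and l: "l \<in> {0<..<1}"
  then have UW: "U \<in> kernels" "W \<in> kernels" by (auto simp: signed_graphons_def)
  show "t (\<lambda>p. l * U p + (1 - l) * W p) \<le> l * t U + (1 - l) * t W"
    using norm_on_kernels_power_convex[OF norming[unfolded norming_def] UW l, of "card E"]
      norming_hom_density_eq[OF UW(1)] norming_hom_density_eq[OF UW(2)]
      norming_hom_density_eq[OF kernels_lincomb[OF UW]] by simp
  show "t (\<lambda>p. l * U p + (1 - l) * W p) < l * t U + (1 - l) * t W" if "\<not> ae_equal U W"
    using UW l that by (rule norming_strict_inequality)
qed

end

end

theorem theorem1p5:
  fixes V :: "'v set" and E :: "'v set set"
  assumes "simple_graph V E" and "E \<noteq> {}"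
  shows "(weakly_norming V E \<longleftrightarrow> convex_parameter_on graphons (hom_density V E)) \<and>
    (norming V E \<longleftrightarrow> strictly_convex_parameter_on signed_graphons (hom_density V E))"
proof -
  interpret nonempty_graph V E
    using assms by unfold_locales
  show ?thesis
    using convex_if_weakly_norming weakly_norming_if_convex
      strictly_convex_if_norming norming_if_strictly_convex by blast
qed

end
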